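(* Let $q\in(0,1)$ and let $G$ be the (proper) joint CDF of a pair $(U,V)$ of nonnegative finite random variables. Then the residual-workload Markov chain $\{\underline{W}^R_n\}$ of the GI/GI/$\infty$ queue with resetting at arrival times (defined in the context) has a stationary probability distribution, characterized by $$\underline{F}^R=q\Big(\underline{e}^{(1)}+(1-q)\,\underline{K}\,\underline{e}^{(1)}+(1-q)^2\,\underline{K}^2\,\underline{e}^{(1)}+\cdots\Big),$$ where $\underline{F}^R=(F^R_0,F^R_1,F^R_2,\dots)$ is the sequence describing this distribution and $\underline{e}^{(1)}=(1,0,0,\dots)$.
   Context: State space: for $s\ge1$ let $\mathbb{O}^s=\{\underline{x}=(x_1,\dots,x_s):x_1\ge\cdots\ge x_s>0\}$; let $\mathbb{O}^0=\{\mathfrak{E}\}$ be a single point (empty system, regarded as the vector of dimension $0$); $\underline{\mathbb{O}}=\bigcup_{s\ge0}\mathbb{O}^s$. Update map: for $\underline{w}\in\mathbb{O}^l$ and $u,v\ge0$ let $\Phi(\underline{w},u,v)\in\underline{\mathbb{O}}$ be obtained by forming the concatenated vector $(v,\underline{w})\in\mathbb{R}^{l+1}$, subtracting $u$ from every entry, replacing negative entries by $0$, deleting the zero entries (the result being $\mathfrak{E}$ if nothing remains), and re-arranging the remaining entries in non-increasing order. Chain: $(U_n,V_n)$, $n\ge0$, are i.i.d. with joint CDF $G$ ($U_n$ inter-arrival time, $V_n$ service time), and independently at each step $\underline{W}^R_{n+1}=\mathfrak{E}$ with probability $q$ and $\underline{W}^R_{n+1}=\Phi(\underline{W}^R_n,U_n,V_n)$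 with probability $1-q$. Description of distributions: a probability distribution on $\underline{\mathbb{O}}$, being the law of $\underline{W}$, is described by the sequence $\underline{F}=(F_0,F_1,F_2,\dots)$ with $F_0=\mathbb{P}(\underline{W}=\mathfrak{E})$ and, for $k\ge1$, $F_k(\underline{x}^{(k)})=\mathbb{P}(\underline{W}\in\mathbb{O}^k,\ \underline{W}\le\underline{x}^{(k)})$, $\underline{x}^{(k)}\in\mathbb{O}^k$ (inequality entrywise). Thus $\underline{e}^{(1)}=(1,0,0,\dots)$ describes the unit mass at $\mathfrak{E}$. Operator: for such a sequence $\underline{H}=(H_0,H_1,\dots)$, with $dH_l$ denoting the corresponding measure on $\mathbb{O}^l$, $(\underline{K}\,\underline{H})_k=\sum_{l\ge\max(k-1,0)}K_{k,l}H_l$, where $$K_{0,l}H_l=\int_{\mathbb{R}_+^2}\int_{\mathbb{O}^l}\mathbf{1}\big(\Phi(\underline{w},u,v)=\mathfrak{E}\big)\,dH_l(\underline{w})\,dG(u,v),$$ $$(K_{k,l}H_l)(\underline{x}^{(k)})=\int_{\mathbb{R}_+^2}\int_{\mathbb{O}^l}\mathbf{1}\big(\Phi(\underline{w},u,v)\in\mathbb{O}^k,\ \Phi(\underline{w},u,v)\le\underline{x}^{(k)}\big)\,dH_l(\underline{w})\,dG(u,v),\quad k\ge1.$$ $\underline{K}^j$ is the $j$-fold iterate of $\underline{K}$. *)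

theory Defs
  imports "HOL-Probability.Probability"
begin

definition ordvec :: "nat \<Rightarrow> real list set" where
  "ordvec s = {w. length w = s \<and> sorted_wrt (\<ge>) w \<and> (\<forall>x\<in>set w. 0 < x)}"

(* The empty system is the empty list, the only element of ordvec 0. *)
definition states :: "real list set" where
  "states = (\<Union>s. ordvec s)"

(* The Borel sigma-algebra of the disjoint union of the ordvec s, each regarded as a subset
   of s-dimensional Euclidean space: it is generated by the pieces and their coordinates. *)
definition state_space :: "real list measure" where
  "state_space = sigma states
     (range ordvec \<union> {{w \<in> ordvec s. w ! i \<le> a} | s i a. i < s})"

definition Phi :: "real list \<Rightarrow> real \<Rightarrow> real \<Rightarrow> real list" where
  "Phi w u v = rev (sort (filter (\<lambda>x. x \<noteq> 0) (map (\<lambda>x. max (x - u) 0) (v # w))))"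

(* The law on the plane with joint CDF G; it is unique whenever it exists. *)
definition cdf_measure :: "(real \<Rightarrow> real \<Rightarrow> real) \<Rightarrow> (real \<times> real) measure" where
  "cdf_measure G = (THE \<mu>. prob_space \<mu> \<and> sets \<mu> = sets borel \<and>
     (\<forall>u v. measure \<mu> ({..u} \<times> {..v}) = G u v))"

(* One step is driven by ((U_n, V_n), R_n), where R_n = True means that the system is reset. *)
primrec workload :: "real list \<Rightarrow> (nat \<Rightarrow> (real \<times> real) \<times> bool) \<Rightarrow> nat \<Rightarrow> real list" where
  "workload w \<omega> 0 = w"
| "workload w \<omega> (Suc n) =
     (case \<omega> n of ((u, v), r) \<Rightarrow> if r then [] else Phi (workload w \<omega> n) u v)"

(* The canonical probability space of the chain: the initial state has law \<pi> and is independent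
   of the driving sequence, whose terms are i.i.d., with independent components of law G and
   Bernoulli(q). *)
definition chain_space ::
  "real \<Rightarrow> (real \<Rightarrow> real \<Rightarrow> real) \<Rightarrow> real list measure \<Rightarrow>
     (real list \<times> (nat \<Rightarrow> (real \<times> real) \<times> bool)) measure" where
  "chain_space q G \<pi> =
     \<pi> \<Otimes>\<^sub>M (\<Pi>\<^sub>M n\<in>UNIV. cdf_measure G \<Otimes>\<^sub>M measure_pmf (bernoulli_pmf q))"

definition stationary_distribution ::
  "real \<Rightarrow> (real \<Rightarrow> real \<Rightarrow> real) \<Rightarrow> real list measure \<Rightarrow> bool" where
  "stationary_distribution q G \<pi> \<longleftrightarrow>
     \<pi> \<in> space (prob_algebra state_space) \<and>
     (\<forall>n. distr (chain_space q G \<pi>) state_space (\<lambda>(w, \<omega>). workload w \<omega> n) = \<pi>)"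

(* A sequence (H_0, H_1, ...) is a function of k and of a point x, meaningful for x in ordvec k
   only. The number H_0 is the value at k = 0, x = []; for this k and x the
   condition "w in ordvec k and w \<le> x" reduces to w = []. *)
type_synonym cdf_seq = "nat \<Rightarrow> real list \<Rightarrow> real"

definition lower_set :: "nat \<Rightarrow> real list \<Rightarrow> real list set" where
  "lower_set k x = {w \<in> ordvec k. list_all2 (\<le>) w x}"

definition describing_seq :: "real list measure \<Rightarrow> cdf_seq" where
  "describing_seq \<pi> k x = measure \<pi> (lower_set k x)"

definition e1 :: cdf_seq where
  "e1 k x = (if k = 0 then 1 else 0)"

(* The measure dH_l on ordvec l that corresponds to the function h = H_l. *)
definition piece_measure :: "nat \<Rightarrow> (real list \<Rightarrow> real) \<Rightarrow> real list measure" where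
  "piece_measure l h = (THE \<mu>. finite_measure \<mu> \<and>
     sets \<mu> = sets (restrict_space state_space (ordvec l)) \<and>
     (\<forall>x\<in>ordvec l. measure \<mu> (lower_set l x) = h x))"

definition K_entry ::
  "(real \<Rightarrow> real \<Rightarrow> real) \<Rightarrow> nat \<Rightarrow> nat \<Rightarrow> (real list \<Rightarrow> real) \<Rightarrow> real list \<Rightarrow> real" where
  "K_entry G k l h x =
     (LINT uv:{0..} \<times> {0..}|cdf_measure G.
        (LINT w|piece_measure l h. indicator (lower_set k x) (Phi w (fst uv) (snd uv))))"

(* Truncated subtraction: k - 1 on nat is max (k - 1) 0. *)
definition K_op :: "(real \<Rightarrow> real \<Rightarrow> real) \<Rightarrow> cdf_seq \<Rightarrow> cdf_seq" where
  "K_op G H k x = (\<Sum>\<^sub>\<infinity>l\<in>{k - 1..}. K_entry G k l (H l) x)"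

end

theory Submission
  imports Defs
begin

text \<open>Let \<open>B\<close> be the backward operator of the unreset chain, \<open>(B f) w = E f (Phi w U V)\<close>. Conditioning
  on the first reset variable, a law \<open>\<pi>\<close> is stationary iff \<open>\<pi> f = q f([]) + (1 - q) \<pi> (B f)\<close> for all
  \<open>f \<ge> 0\<close>. Unfolding this equation \<open>n\<close> times leaves a remainder of at most \<open>(1 - q)^n\<close> on indicators,
  whence \<open>\<pi> = q \<Sum> (1 - q)^j \<lambda>\<^sub>j\<close>, where \<open>\<lambda>\<^sub>j\<close> is the law of the unreset chain after \<open>j\<close> steps from the
  empty system. Conversely this mixture satisfies the equation. The orthants
  \<open>lower_set k x\<close> form an intersection-stable generator of each piece, so \<open>\<lambda>\<^sub>j\<close> is determined by its
  describing sequence, which is \<open>K\<^sup>j e\<^sub>1\<close>.\<close>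

subsection \<open>The state space\<close>

lemma states_iff: "w \<in> states \<longleftrightarrow> sorted_wrt (\<ge>) w \<and> (\<forall>x\<in>set w. 0 < x)"
  by (auto simp: states_def ordvec_def)

lemma ordvec_eq_states: "ordvec s = {w \<in> states. length w = s}"
  by (auto simp: states_iff ordvec_def)

lemma ordvec_iff_nth:
  "w \<in> ordvec s \<longleftrightarrow>
    length w = s \<and> (\<forall>i j. i \<le> j \<longrightarrow> j < s \<longrightarrow> w ! j \<le> w ! i) \<and> (\<forall>i<s. 0 < w ! i)"
  unfolding ordvec_def sorted_wrt_iff_nth_less all_set_conv_all_nth
  by (auto simp: le_less)

lemma ordvec_nth_mono: "w \<in> ordvec s \<Longrightarrow> i \<le> j \<Longrightarrow> j < s \<Longrightarrow> w ! j \<le> w ! i"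
  by (simp add: ordvec_iff_nth)

lemma ordvec_nth_pos: "w \<in> ordvec s \<Longrightarrow> i < s \<Longrightarrow> 0 < w ! i"
  by (simp add: ordvec_iff_nth)

lemma ordvec_length: "w \<in> ordvec s \<Longrightarrow> length w = s"
  by (simp add: ordvec_iff_nth)

lemma ordvec_disjoint: "s \<noteq> k \<Longrightarrow> ordvec k \<inter> ordvec s = {}"
  by (auto simp: ordvec_def)

lemma ordvec_subset_states: "ordvec s \<subseteq> states"
  by (auto simp: ordvec_eq_states)

lemma ordvec_0 [simp]: "ordvec 0 = {[]}"
  by (auto simp: ordvec_def)

lemma Nil_in_states [simp]: "[] \<in> states"
  by (simp add: states_iff)

lemma state_space_generators:
  "range ordvec \<union> {{w \<in> ordvec s. w ! i \<le> a} | s i a. i < s} \<subseteq> Pow states"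
  by (auto simp: ordvec_eq_states)

lemma space_state_space [simp]: "space state_space = states"
  unfolding state_space_def by (rule space_measure_of[OF state_space_generators])

lemma const_in_state_space: "w \<in> states \<Longrightarrow> (\<lambda>_. w) \<in> N \<rightarrow>\<^sub>M state_space"
  by simp

lemma sets_state_space:
  "sets state_space =
     sigma_sets states (range ordvec \<union> {{w \<in> ordvec s. w ! i \<le> a} | s i a. i < s})"
  unfolding state_space_def by (rule sets_measure_of[OF state_space_generators])

lemma sets_ordvec [measurable]: "ordvec s \<in> sets state_space"
  by (auto simp: sets_state_space)

lemma sets_coordinate_le:
  assumes "i < s"
  shows "{w \<in> ordvec s. w ! i \<le> a} \<in> sets state_space"
  unfolding sets_state_space using assms by blast

lemma lower_set_subset: "lower_set k x \<subseteq> ordvec k"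
  by (auto simp: lower_set_def)

lemma sets_lower_set [measurable]: "lower_set k x \<in> sets state_space"
proof (cases "length x = k")
  case True
  show ?thesis
  proof (cases "k = 0")
    case False
    have "lower_set k x = ordvec k \<inter> (\<Inter>i\<in>{..<k}. {w \<in> ordvec k. w ! i \<le> x ! i})"
      using True by (auto simp: lower_set_def list_all2_conv_all_nth dest: ordvec_length)
    also have "\<dots> \<in> sets state_space"
      using False by (intro sets.Int sets_ordvec sets.finite_INT sets_coordinate_le) auto
    finally show ?thesis .
  next
    case k: True
    then have "lower_set k x = ordvec k"
      using True by (simp add: lower_set_def)
    then show ?thesis by simp
  qed
next
  case False
  then have "lower_set k x = {}"
    by (auto simp: lower_set_def dest!: ordvec_length list_all2_lengthD)
  then show ?thesis by simp
qed

text \<open>The number of coordinates exceeding a level generates the \<open>\<sigma>\<close>-algebra and, unlike the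
  coordinates, transforms under \<open>Phi\<close> without any sorting.\<close>

definition exceed_count :: "real \<Rightarrow> real list \<Rightarrow> nat" where
  "exceed_count c w = length (filter (\<lambda>x. c < x) w)"

text \<open>The entries above \<open>c\<close> form an initial segment of a non-increasing list, so
  their number is at most \<open>i\<close> exactly when the entry at index \<open>i\<close>, if
  there is one, is not above \<open>c\<close>. Counts thus carry the same information as
  coordinates.\<close>

lemma exceed_count_le_iff:
  assumes "sorted_wrt (\<ge>) w"
  shows "exceed_count c w \<le> i \<longleftrightarrow> length w \<le> i \<or> w ! i \<le> c"
  using assms
proof (induction w arbitrary: i)
  case Nil
  then show ?case by (simp add: exceed_count_def)
next
  case (Cons a w)
  show ?case
  proof (cases "c < a")
    case True
    moreover have "exceed_count c w \<le> j \<longleftrightarrow> length w \<le> j \<or> w ! j \<le> c" for j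
      using Cons by simp
    ultimately show ?thesis
      by (cases i) (simp_all add: exceed_count_def)
  next
    case False
    then have "exceed_count c (a # w) = 0"
      using Cons.prems by (fastforce simp: exceed_count_def filter_empty_conv)
    moreover have "(a # w) ! i \<le> c" if "i < length (a # w)"
      using that False Cons.prems by (cases i) (auto simp: all_set_conv_all_nth)
    ultimately show ?thesis
      by (metis le0 not_le)
  qed
qed

text \<open>For a level \<open>t \<ge> 0\<close> neither replacing negative entries by 0 nor
  deleting zeros changes which entries lie above \<open>t\<close>, and sorting does not change a
  count. Only the shift by \<open>u\<close> and the new entry \<open>v\<close> remain.\<close>

lemma exceed_count_Phi:
  assumes "0 \<le> t"
  shows "exceed_count t (Phi w u v) = (if t + u < v then 1 else 0) + exceed_count (t + u) w"
proof -
  have *: "length (filter P (rev (sort xs))) = length (filter P xs)" for P and xs :: "real list"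
    by (metis filter_sort length_rev length_sort rev_filter)
  have **: "t < max (x - u) 0 \<and> max (x - u) 0 \<noteq> 0 \<longleftrightarrow> t + u < x" for x
    using assms by (auto simp: max_def)
  have "(\<lambda>x. (t < x \<and> x \<noteq> 0)) \<circ> (\<lambda>x. max (x - u) 0) = (\<lambda>x. t + u < x)"
    by (rule ext) (use ** in simp)
  then show ?thesis
    unfolding exceed_count_def Phi_def * filter_filter filter_map length_map
    by (simp add: conj_commute comp_def)
qed

lemma Phi_in_states: "Phi w u v \<in> states"
proof -
  have "sorted_wrt (\<ge>) (rev (sort xs))" for xs :: "real list"
    by (simp add: sorted_wrt_rev)
  then show ?thesis
    by (auto simp: states_iff Phi_def)
qed

text \<open>An arrival adds one entry at most; this is what lets the sum in \<open>K_op\<close>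
  start at \<open>k - 1\<close>.\<close>

lemma length_Phi_le: "length (Phi w u v) \<le> Suc (length w)"
  unfolding Phi_def by (simp del: filter.simps list.map) (metis length_filter_le length_Cons)

lemma exceed_count_0: "w \<in> states \<Longrightarrow> exceed_count 0 w = length w"
  by (simp add: exceed_count_def states_iff)

text \<open>The level varies with the point as well, because \<open>exceed_count_Phi\<close> shifts
  it by the random amount \<open>u\<close>.\<close>

lemma measurable_exceed_count [measurable]:
  assumes [measurable]: "h \<in> borel_measurable N" "g \<in> N \<rightarrow>\<^sub>M state_space"
  shows "(\<lambda>z. exceed_count (h z) (g z)) \<in> N \<rightarrow>\<^sub>M count_space UNIV"
proof -
  have *: "{z \<in> space N. exceed_count (h z) (g z) \<le> i} \<in> sets N" for i
  proof -
    have nth: "(\<lambda>w. if i < length w then w ! i else 0) \<in> borel_measurable state_space"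
    proof (rule borel_measurableI_le)
      fix a
      \<comment> \<open>A list without index \<open>i\<close> has the default value 0, so it
        satisfies the bound exactly when \<open>0 \<le> a\<close>.\<close>
      have "{w \<in> space state_space. (if i < length w then w ! i else 0) \<le> a} =
         (\<Union>s\<in>{i<..}. {w \<in> ordvec s. w ! i \<le> a}) \<union> (if 0 \<le> a then \<Union>s\<in>{..i}. ordvec s else {})"
        by (auto simp: ordvec_eq_states)
      also have "\<dots> \<in> sets state_space"
        by (auto intro!: sets.Un sets.countable_UN'' sets_coordinate_le)
      finally show "{w \<in> space state_space. (if i < length w then w ! i else 0) \<le> a}
          \<in> sets state_space" .
    qed
    have len: "{w \<in> space state_space. length w \<le> i} \<in> sets state_space"
    proof -
      have "{w \<in> space state_space. length w \<le> i} = (\<Union>s\<in>{..i}. ordvec s)"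
        by (auto simp: ordvec_eq_states)
      then show ?thesis by auto
    qed
    \<comment> \<open>By \<open>exceed_count_le_iff\<close>: either the list has no index
      \<open>i\<close>, or its entry there is at most the level.\<close>
    have eq: "{z \<in> space N. exceed_count (h z) (g z) \<le> i} =
        (g -` {w \<in> space state_space. length w \<le> i} \<inter> space N) \<union>
        {z \<in> space N. (if i < length (g z) then g z ! i else 0) \<le> h z} \<inter>
        (space N - (g -` {w \<in> space state_space. length w \<le> i} \<inter> space N))"
    proof -
      have "g z \<in> states" if "z \<in> space N" for z
        using measurable_space[OF assms(2) that] by simp
      then show ?thesis
        by (auto simp: states_iff exceed_count_le_iff)
    qed
    have [measurable]: "(\<lambda>z. if i < length (g z) then g z ! i else 0) \<in> borel_measurable N"
      using measurable_compose[OF assms(2) nth] .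
    show ?thesis
      unfolding eq
      by (intro sets.Un sets.Int sets.Diff sets.top measurable_sets[OF assms(2) len]) measurable
  qed
  show ?thesis
  proof (subst measurable_count_space_eq2_countable, safe)
    fix n :: nat
    have nat_eq_iff: "m = n \<longleftrightarrow> m \<le> n \<and> (\<forall>j<n. \<not> m \<le> j)" for m :: nat
      by (metis le_less nat_le_linear not_le)
    have "(\<lambda>z. exceed_count (h z) (g z)) -` {n} \<inter> space N =
      {z \<in> space N. exceed_count (h z) (g z) \<le> n} -
      (\<Union>m\<in>{..<n}. {z \<in> space N. exceed_count (h z) (g z) \<le> m})"
      unfolding vimage_def singleton_iff nat_eq_iff by blast
    also have "\<dots> \<in> sets N"
      by (intro sets.Diff sets.finite_UN * finite_lessThan)
    finally show "(\<lambda>z. exceed_count (h z) (g z)) -` {n} \<inter> space N \<in> sets N" .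
  qed simp
qed

text \<open>Preimages of the generators become conditions on two counts for the old state: the count
  above 0 is the length of the new state, and the count above \<open>a\<close> locates its
  \<open>i\<close>-th coordinate relative to \<open>a\<close>. Sorting never has to be
  handled.\<close>

lemma measurable_Phi [measurable]:
  assumes [measurable]: "g \<in> N \<rightarrow>\<^sub>M state_space" "U \<in> borel_measurable N" "V \<in> borel_measurable N"
  shows "(\<lambda>z. Phi (g z) (U z) (V z)) \<in> N \<rightarrow>\<^sub>M state_space"
proof -
  let ?f = "\<lambda>z. Phi (g z) (U z) (V z)"
  let ?c = "\<lambda>t z. (if t + U z < V z then 1 else 0) + exceed_count (t + U z) (g z)"
  have ordvec: "?f -` ordvec s \<inter> space N = {z \<in> space N. ?c 0 z = s}" for s
    using exceed_count_0[OF Phi_in_states] exceed_count_Phi[of 0]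
    by (auto simp: ordvec_eq_states Phi_in_states)
  have coord: "?f -` {w \<in> ordvec s. w ! i \<le> a} \<inter> space N =
      (if 0 \<le> a then {z \<in> space N. ?c 0 z = s \<and> ?c a z \<le> i} else {})" if "i < s" for s i a
  proof (cases "0 \<le> a")
    case True
    have "Phi (g z) (U z) (V z) ! i \<le> a \<longleftrightarrow> ?c a z \<le> i"
      if "Phi (g z) (U z) (V z) \<in> ordvec s" for z
    proof -
      have "sorted_wrt (\<ge>) (Phi (g z) (U z) (V z))" "\<not> length (Phi (g z) (U z) (V z)) \<le> i"
        using that \<open>i < s\<close> by (simp_all add: ordvec_def)
      then show ?thesis
        by (simp add: exceed_count_le_iff flip: exceed_count_Phi[OF True])
    qed
    moreover have "Phi (g z) (U z) (V z) \<in> ordvec s \<longleftrightarrow> ?c 0 z = s" if "z \<in> space N" for z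
      using ordvec[of s] that by blast
    ultimately have "?f -` {w \<in> ordvec s. w ! i \<le> a} \<inter> space N =
        {z \<in> space N. ?c 0 z = s \<and> ?c a z \<le> i}"
      by blast
    with True show ?thesis by simp
  next
    case False
    \<comment> \<open>Coordinates are positive, so a negative bound \<open>a\<close> gives an empty
      set.\<close>
    have *: "\<not> w ! i \<le> a" if "w \<in> ordvec s" for w
      using ordvec_nth_pos[OF that \<open>i < s\<close>] False by simp
    have "?f -` {w \<in> ordvec s. w ! i \<le> a} \<inter> space N = {}"
      using * by blast
    with False show ?thesis by simp
  qed
  have [measurable]: "?c t \<in> N \<rightarrow>\<^sub>M count_space UNIV" for t
    by measurable
  show ?thesis
    unfolding state_space_def
  proof (rule measurable_measure_of[OF state_space_generators])
    show "?f \<in> space N \<rightarrow> states" by (simp add: Phi_in_states)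
    fix A assume "A \<in> range ordvec \<union> {{w \<in> ordvec s. w ! i \<le> a} | s i a. i < s}"
    then consider s where "A = ordvec s" | s i a where "i < s" "A = {w \<in> ordvec s. w ! i \<le> a}"
      by blast
    then show "?f -` A \<inter> space N \<in> sets N"
    proof cases
      case 1
      then show ?thesis unfolding 1 ordvec by measurable
    next
      case 2
      show ?thesis unfolding 2 coord[OF 2(1)] by (cases "0 \<le> a") (simp_all, measurable)
    qed
  qed
qed

subsection \<open>Uniqueness of measures with given distribution functions\<close>

text \<open>The entrywise minimum of two non-increasing positive vectors is again such a vector, and
  it is the corner of the intersection.\<close>

lemma Int_stable_lower_set: "Int_stable (lower_set k ` ordvec k)"
proof (rule Int_stableI_image)
  fix x y assume xy: "x \<in> ordvec k" "y \<in> ordvec k"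
  let ?z = "map (\<lambda>i. min (x ! i) (y ! i)) [0..<k]"
  have "?z \<in> ordvec k"
    unfolding ordvec_iff_nth
  proof (intro conjI allI impI)
    show "?z ! j \<le> ?z ! i" if "i \<le> j" "j < k" for i j
      using that min.mono[OF xy[THEN ordvec_nth_mono, OF that]] by simp
    show "0 < ?z ! i" if "i < k" for i
      using that xy[THEN ordvec_nth_pos] by simp
  qed simp
  moreover have "lower_set k x \<inter> lower_set k y = lower_set k ?z"
    using xy[THEN ordvec_length] by (auto simp: lower_set_def list_all2_conv_all_nth)
  ultimately show "\<exists>z\<in>ordvec k. lower_set k x \<inter> lower_set k y = lower_set k z" by blast
qed

lemma replicate_append_in_ordvec:
  assumes "0 < a" "a \<le> b" "i \<le> k"
  shows "replicate i b @ replicate (k - i) a \<in> ordvec k"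
  unfolding ordvec_iff_nth
proof (intro conjI allI impI)
  let ?x = "replicate i b @ replicate (k - i) a"
  show "?x ! m \<le> ?x ! j" if "j \<le> m" "m < k" for j m
    using that assms by (simp add: nth_append)
  show "0 < ?x ! j" if "j < k" for j
    using that assms by (simp add: nth_append)
qed (use assms in simp)

text \<open>A bound on the entry at index \<open>i\<close> bounds all later entries by monotonicity.
  The earlier entries are unrestricted, but the corner has to be non-increasing, so they are bounded
  by \<open>max a (real n)\<close> and \<open>n\<close> grows to infinity.\<close>

lemma coordinate_le_eq_UN_lower_set:
  assumes "i < k" "0 < a"
  shows "{w \<in> ordvec k. w ! i \<le> a} =
    (\<Union>n. lower_set k (replicate i (max a (real n)) @ replicate (k - i) a))"
proof (intro equalityI subsetI)
  fix w assume w: "w \<in> {w \<in> ordvec k. w ! i \<le> a}"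
  obtain n where n: "Max (set w) \<le> real n"
    using real_arch_simple by blast
  have len: "length w = k"
    using w ordvec_length by blast
  have le_n: "w ! j \<le> real n" if "j < k" for j
    using that len by (intro order.trans[OF Max_ge n]) auto
  have le_a: "w ! j \<le> a" if "i \<le> j" "j < k" for j
    using that w ordvec_nth_mono[of w k i j] by simp
  have "w ! j \<le> (replicate i (max a (real n)) @ replicate (k - i) a) ! j" if "j < k" for j
    using le_n[OF that] le_a[OF _ that] that by (cases "j < i") (simp_all add: nth_append)
  then have "w \<in> lower_set k (replicate i (max a (real n)) @ replicate (k - i) a)"
    using w \<open>i < k\<close> len by (simp add: lower_set_def list_all2_conv_all_nth)
  then show "w \<in> (\<Union>n. lower_set k (replicate i (max a (real n)) @ replicate (k - i) a))" by blast
next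
  fix w assume "w \<in> (\<Union>n. lower_set k (replicate i (max a (real n)) @ replicate (k - i) a))"
  then obtain n where w: "w \<in> ordvec k"
    "list_all2 (\<le>) w (replicate i (max a (real n)) @ replicate (k - i) a)"
    by (auto simp: lower_set_def)
  then show "w \<in> {w \<in> ordvec k. w ! i \<le> a}"
    using list_all2_nthD[OF w(2), of i] assms ordvec_length[OF w(1)] by (simp add: nth_append)
qed

text \<open>The successor keeps every corner positive, hence in \<open>ordvec k\<close>; these cubes
  exhaust the piece in the uniqueness argument.\<close>

lemma ordvec_eq_UN_lower_set: "ordvec k = (\<Union>n. lower_set k (replicate k (real (Suc n))))"
proof (intro equalityI subsetI)
  fix w assume w: "w \<in> ordvec k"
  obtain n where n: "Max (set w) \<le> real n"
    using real_arch_simple by blast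
  have len: "length w = k"
    using w ordvec_length by blast
  have "w ! j \<le> real (Suc n)" if "j < k" for j
    using that len order.trans[OF Max_ge n, of "w ! j"] by simp
  then have "w \<in> lower_set k (replicate k (real (Suc n)))"
    using w len by (simp add: lower_set_def list_all2_conv_all_nth)
  then show "w \<in> (\<Union>n. lower_set k (replicate k (real (Suc n))))" by blast
qed (use lower_set_subset in blast)

text \<open>On one piece the generators of \<open>state_space\<close> leave the piece itself, the
  empty set and the coordinate half-spaces with a positive bound, all of them countable unions of
  lower sets or trivial.\<close>

lemma sets_restrict_state_space:
  "sets (restrict_space state_space (ordvec k)) = sigma_sets (ordvec k) (lower_set k ` ordvec k)"
proof
  let ?S = "sigma_sets (ordvec k) (lower_set k ` ordvec k)"
  let ?gen = "range ordvec \<union> {{w \<in> ordvec s. w ! i \<le> a} | s i a. i < s}"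
  have "sets (restrict_space state_space (ordvec k)) = (\<inter>) (ordvec k) ` sets state_space"
    by (simp add: sets_restrict_space)
  also have "\<dots> = sigma_sets (ordvec k) ((\<inter>) (ordvec k) ` ?gen)"
    unfolding sets_state_space
    by (rule sigma_sets_Int)
       (use sets_ordvec ordvec_subset_states in \<open>simp_all flip: sets_state_space\<close>)
  also have "\<dots> \<subseteq> ?S"
  proof (rule sigma_sets_mono, rule subsetI)
    fix B assume "B \<in> (\<inter>) (ordvec k) ` ?gen"
    then consider s where "B = ordvec k \<inter> ordvec s"
      | s i a where "i < s" "B = ordvec k \<inter> {w \<in> ordvec s. w ! i \<le> a}"
      by blast
    then show "B \<in> ?S"
    proof cases
      case 1
      then show ?thesis
        by (cases "s = k")
           (simp_all add: sigma_sets_top sigma_sets.Empty ordvec_disjoint)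
    next
      case 2
      show ?thesis
      proof (cases "s = k \<and> 0 < a")
        case True
        then have "B = {w \<in> ordvec k. w ! i \<le> a}"
          using 2 by blast
        also have "\<dots> = (\<Union>n. lower_set k (replicate i (max a (real n)) @ replicate (k - i) a))"
          using True 2 coordinate_le_eq_UN_lower_set by blast
        also have "\<dots> \<in> ?S"
          using True 2 replicate_append_in_ordvec
          by (intro sigma_sets.Union sigma_sets.Basic imageI) auto
        finally show ?thesis .
      next
        case False
        \<comment> \<open>Either the two pieces are disjoint, or \<open>a \<le> 0\<close>
          contradicts the positivity of the coordinates.\<close>
        have "False" if "w \<in> B" for w
          using that False 2 ordvec_nth_pos[of w s i] ordvec_length[of w s] ordvec_length[of w k]
          by auto
        then have "B = {}" by blast
        then show ?thesis by (simp add: sigma_sets.Empty)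
      qed
    qed
  qed
  finally show "sets (restrict_space state_space (ordvec k)) \<subseteq> ?S" .
  have "lower_set k ` ordvec k \<subseteq> sets (restrict_space state_space (ordvec k))"
    using lower_set_subset ordvec_subset_states
    by (simp add: sets_restrict_space_iff Int_absorb2 image_subset_iff)
  moreover have "space (restrict_space state_space (ordvec k)) = ordvec k"
    by (auto simp: space_restrict_space ordvec_eq_states)
  ultimately show "?S \<subseteq> sets (restrict_space state_space (ordvec k))"
    by (metis sets.sigma_sets_subset)
qed

text \<open>The pi-lambda theorem applies: lower sets are an intersection-stable generator and the
  cubes exhaust the piece. This is the uniqueness behind the \<open>THE\<close> in
  \<open>piece_measure\<close>.\<close>

lemma piece_measure_unique:
  assumes "finite_measure \<mu>" "finite_measure \<nu>"
    and "sets \<mu> = sets (restrict_space state_space (ordvec k))"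
    and "sets \<nu> = sets (restrict_space state_space (ordvec k))"
    and "\<And>x. x \<in> ordvec k \<Longrightarrow> measure \<mu> (lower_set k x) = measure \<nu> (lower_set k x)"
  shows "\<mu> = \<nu>"
proof (rule measure_eqI_generator_eq[OF Int_stable_lower_set, where \<Omega> = "ordvec k" and
      A = "\<lambda>n. lower_set k (replicate k (real (Suc n)))"])
  show "range (\<lambda>n. lower_set k (replicate k (real (Suc n)))) \<subseteq> lower_set k ` ordvec k"
    using replicate_append_in_ordvec[of "real (Suc _)" _ 0 k] by (auto intro!: imageI)
  show "emeasure \<mu> X = emeasure \<nu> X" if "X \<in> lower_set k ` ordvec k" for X
    using that assms by (auto simp: finite_measure.emeasure_eq_measure)
  show "(\<Union>n. lower_set k (replicate k (real (Suc n)))) = ordvec k"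
    by (rule ordvec_eq_UN_lower_set[symmetric])
qed (use assms lower_set_subset[THEN subsetD] in
      \<open>auto simp: sets_restrict_state_space finite_measure.emeasure_eq_measure\<close>)

text \<open>Evaluates the definite description: for a function that comes from a finite measure on
  all states, the measure dH_k is the restriction of that measure.\<close>

lemma piece_measure_eq:
  assumes "finite_measure \<nu>" "sets \<nu> = sets state_space"
    and "\<And>x. x \<in> ordvec k \<Longrightarrow> h x = measure \<nu> (lower_set k x)"
  shows "piece_measure k h = restrict_space \<nu> (ordvec k)"
proof -
  let ?R = "restrict_space \<nu> (ordvec k)"
  interpret finite_measure \<nu> by fact
  have R: "finite_measure ?R" "sets ?R = sets (restrict_space state_space (ordvec k))"
    "measure ?R (lower_set k x) = measure \<nu> (lower_set k x)" for x
    using assms lower_set_subset[THEN subsetD]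
    by (auto intro!: finite_measure_restrict_space sets_restrict_space_cong measure_restrict_space
        simp: sets_eq_imp_space_eq[OF assms(2)] Int_absorb2[OF ordvec_subset_states])
  show ?thesis
    unfolding piece_measure_def
  proof (rule the_equality)
    fix \<mu> assume "finite_measure \<mu> \<and> sets \<mu> = sets (restrict_space state_space (ordvec k)) \<and>
      (\<forall>x\<in>ordvec k. measure \<mu> (lower_set k x) = h x)"
    then show "\<mu> = ?R"
      using R assms(3) by (intro piece_measure_unique[of \<mu> ?R k]) auto
  qed (use R assms(3) in auto)
qed

text \<open>A law is the sum of its restrictions to the countably many disjoint pieces, and each
  restriction is determined by its distribution function.\<close>

lemma describing_seq_inj:
  assumes "prob_space \<pi>" "prob_space \<rho>" "sets \<pi> = sets state_space" "sets \<rho> = sets state_space"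
    and "\<And>k x. x \<in> ordvec k \<Longrightarrow> describing_seq \<pi> k x = describing_seq \<rho> k x"
  shows "\<pi> = \<rho>"
proof (rule measure_eqI)
  interpret \<pi>: prob_space \<pi> by fact
  interpret \<rho>: prob_space \<rho> by fact
  fix A assume "A \<in> sets \<pi>"
  with assms have A: "A \<in> sets state_space" by simp
  \<comment> \<open>Both restrictions are the \<open>piece_measure\<close> of the same
    function.\<close>
  have restr: "restrict_space \<pi> (ordvec k) = restrict_space \<rho> (ordvec k)" for k
    using assms piece_measure_eq[of \<pi> k "describing_seq \<pi> k"]
      piece_measure_eq[of \<rho> k "describing_seq \<pi> k"]
      \<pi>.finite_measure_axioms \<rho>.finite_measure_axioms
    by (simp add: describing_seq_def)
  have piece: "emeasure \<pi> (A \<inter> ordvec k) = emeasure \<rho> (A \<inter> ordvec k)" for k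
  proof -
    have "emeasure \<nu> (A \<inter> ordvec k) = emeasure (restrict_space \<nu> (ordvec k)) (A \<inter> ordvec k)"
      if "sets \<nu> = sets state_space" for \<nu>
      using that sets_eq_imp_space_eq[OF that]
      by (intro emeasure_restrict_space[symmetric])
         (simp_all add: Int_absorb2[OF ordvec_subset_states])
    then show ?thesis using restr assms(3,4) by simp
  qed
  have disj: "disjoint_family (\<lambda>k. A \<inter> ordvec k)"
    by (auto simp: disjoint_family_on_def ordvec_def)
  have "A = (\<Union>k. A \<inter> ordvec k)"
    using sets.sets_into_space[OF A] by (auto simp: states_def)
  moreover have "range (\<lambda>k. A \<inter> ordvec k) \<subseteq> sets state_space"
    using A by auto
  ultimately show "emeasure \<pi> A = emeasure \<rho> A"
    using disj piece suminf_emeasure[of "\<lambda>k. A \<inter> ordvec k" \<pi>]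
      suminf_emeasure[of "\<lambda>k. A \<inter> ordvec k" \<rho>] assms(3,4) by simp
qed (use assms in simp)

text \<open>In the product order a quadrant is a set \<open>{..z}\<close>; these sets are closed
  under intersection and generate the Borel sets. This supplies the uniqueness for the
  \<open>THE\<close> in \<open>cdf_measure\<close>.\<close>

lemma prod_measure_eqI_quadrants:
  fixes \<mu> \<nu> :: "(real \<times> real) measure"
  assumes "prob_space \<mu>" "prob_space \<nu>" "sets \<mu> = sets borel" "sets \<nu> = sets borel"
    and "\<And>u v. measure \<mu> ({..u} \<times> {..v}) = measure \<nu> ({..u} \<times> {..v})"
  shows "\<mu> = \<nu>"
proof -
  interpret \<mu>: prob_space \<mu> by fact
  interpret \<nu>: prob_space \<nu> by fact
  have atMost: "{..z} = {..fst z} \<times> {..snd z}" for z :: "real \<times> real"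
    by (auto simp: less_eq_prod_def)
  have sets: "sets borel = sigma_sets UNIV (range (atMost :: real \<times> real \<Rightarrow> _))"
    by (simp add: borel_eq_atMost)
  show ?thesis
  proof (rule measure_eqI_generator_eq[where E = "range atMost" and \<Omega> = UNIV and
        A = "\<lambda>n. {..(real n, real n)}"])
    show "Int_stable (range (atMost :: real \<times> real \<Rightarrow> _))"
    proof (rule Int_stableI_image)
      fix y z :: "real \<times> real"
      have "{..y} \<inter> {..z} = {..(min (fst y) (fst z), min (snd y) (snd z))}"
        by (auto simp: less_eq_prod_def)
      then show "\<exists>x\<in>UNIV. {..y} \<inter> {..z} = {..x}" by blast
    qed
    have "\<exists>n. z \<le> (real n, real n)" for z :: "real \<times> real"
    proof -
      obtain n where "max (fst z) (snd z) \<le> real n"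
        using real_arch_simple by blast
      then show ?thesis by (auto simp: less_eq_prod_def)
    qed
    then show "(\<Union>n. {..(real n, real n)}) = UNIV" by auto
    show "emeasure \<mu> X = emeasure \<nu> X" if "X \<in> range atMost" for X
      using that assms(5) by (auto simp: \<mu>.emeasure_eq_measure \<nu>.emeasure_eq_measure atMost)
  qed (use assms sets in auto)
qed

lemma cdf_measure_eq:
  assumes "prob_space \<mu>" "sets \<mu> = sets borel"
    and "\<And>u v. G u v = measure \<mu> ({..u} \<times> {..v})"
  shows "cdf_measure G = \<mu>"
  unfolding cdf_measure_def using assms
  by (intro the_equality) (auto intro!: prod_measure_eqI_quadrants)

subsection \<open>Stationarity\<close>

definition chain_step :: "real list \<Rightarrow> (real \<times> real) \<times> bool \<Rightarrow> real list" where
  "chain_step w d = (if snd d then [] else Phi w (fst (fst d)) (snd (fst d)))"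

lemma workload_Suc: "workload w \<omega> (Suc n) = chain_step (workload w \<omega> n) (\<omega> n)"
  by (simp add: chain_step_def split_beta)

text \<open>The recursion splits off the last step, whereas conditioning on the first driving term
  needs the first step split off. Here \<open>case_nat d \<omega>\<close> is the sequence
  \<open>\<omega>\<close> with \<open>d\<close> put in front.\<close>

lemma workload_case_nat: "workload w (case_nat d \<omega>) (Suc n) = workload (chain_step w d) \<omega> n"
proof (induction n)
  case 0
  then show ?case by (simp only: workload_Suc workload.simps(1) nat.case)
next
  case (Suc n)
  then show ?case by (simp only: workload_Suc[of w _ "Suc n"] workload_Suc[of _ \<omega>] nat.case)
qed

locale workload_chain = prob_space \<mu> for \<mu> :: "(real \<times> real) measure" +
  fixes q :: real
  assumes sets_\<mu>: "sets \<mu> = sets borel"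
    and q_pos: "0 < q" and q_less_1: "q < 1"
begin

lemma space_\<mu>: "space \<mu> = UNIV"
  using sets_eq_imp_space_eq[OF sets_\<mu>] by simp

lemma measurable_fst_\<mu> [measurable]: "fst \<in> borel_measurable \<mu>"
  and measurable_snd_\<mu> [measurable]: "snd \<in> borel_measurable \<mu>"
  by (simp_all add: measurable_cong_sets[OF sets_\<mu> refl] flip: borel_prod)

section \<open>Dual one-step operators and the laws of the unreset chain\<close>

definition backward :: "(real list \<Rightarrow> ennreal) \<Rightarrow> real list \<Rightarrow> ennreal" where
  "backward f w = (\<integral>\<^sup>+ z. f (Phi w (fst z) (snd z)) \<partial>\<mu>)"

definition forward :: "real list measure \<Rightarrow> real list measure" where
  "forward \<nu> = distr (\<nu> \<Otimes>\<^sub>M \<mu>) state_space (\<lambda>(w, z). Phi w (fst z) (snd z))"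

definition law :: "nat \<Rightarrow> real list measure" where
  "law n = (forward ^^ n) (return state_space [])"

text \<open>Stated for test functions instead of sets, so that the equation can be applied again to
  \<open>backward f\<close>.\<close>

definition invariant :: "real list measure \<Rightarrow> bool" where
  "invariant \<pi> \<longleftrightarrow> (\<forall>f \<in> borel_measurable state_space.
     (\<integral>\<^sup>+ w. f w \<partial>\<pi>) = ennreal q * f [] + ennreal (1 - q) * (\<integral>\<^sup>+ w. backward f w \<partial>\<pi>))"

lemma measurable_backward [measurable]:
  assumes [measurable]: "f \<in> borel_measurable state_space"
  shows "backward f \<in> borel_measurable state_space"
  unfolding backward_def by measurable

lemma measurable_backward_funpow [measurable]:
  "f \<in> borel_measurable state_space \<Longrightarrow> (backward ^^ n) f \<in> borel_measurable state_space"
  by (induction n) simp_all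

text \<open>An average of values at most 1 is at most 1; for indicators this bounds the remainder of
  the unfolded equation.\<close>

lemma backward_funpow_le_1:
  assumes "\<And>w. f w \<le> 1"
  shows "(backward ^^ n) f w \<le> 1"
proof (induction n arbitrary: w)
  case (Suc n)
  have "backward ((backward ^^ n) f) w \<le> (\<integral>\<^sup>+ z. 1 \<partial>\<mu>)"
    by (subst backward_def) (intro nn_integral_mono Suc)
  then show ?case by (simp add: emeasure_space_1)
qed (simp add: assms)

lemma measurable_Phi_pair:
  assumes "sets \<nu> = sets state_space"
  shows "(\<lambda>(w, z). Phi w (fst z) (snd z)) \<in> \<nu> \<Otimes>\<^sub>M \<mu> \<rightarrow>\<^sub>M state_space"
proof -
  have "(\<lambda>(w, z). Phi w (fst z) (snd z)) \<in> state_space \<Otimes>\<^sub>M \<mu> \<rightarrow>\<^sub>M state_space"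
    by measurable
  then show ?thesis
    using measurable_cong_sets[OF sets_pair_measure_cong[OF assms refl, of \<mu>] refl, of state_space]
    by simp
qed

text \<open>Fubini on the product of \<open>\<nu>\<close> and \<open>\<mu>\<close>:
  \<open>forward\<close> is the adjoint of \<open>backward\<close>.\<close>

lemma nn_integral_forward:
  assumes "sets \<nu> = sets state_space" and [measurable]: "f \<in> borel_measurable state_space"
  shows "(\<integral>\<^sup>+ w. f w \<partial>forward \<nu>) = (\<integral>\<^sup>+ w. backward f w \<partial>\<nu>)"
proof -
  note [measurable] = measurable_Phi_pair[OF assms(1)]
  have "(\<integral>\<^sup>+ w. f w \<partial>forward \<nu>) = (\<integral>\<^sup>+ x. f (case x of (w, z) \<Rightarrow> Phi w (fst z) (snd z)) \<partial>(\<nu> \<Otimes>\<^sub>M \<mu>))"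
    unfolding forward_def by (rule nn_integral_distr) measurable
  also have "\<dots> = (\<integral>\<^sup>+ w. backward f w \<partial>\<nu>)"
    unfolding backward_def by (subst nn_integral_fst[symmetric]) simp_all
  finally show ?thesis .
qed

lemma forward_in_prob_algebra:
  assumes "\<nu> \<in> space (prob_algebra state_space)"
  shows "forward \<nu> \<in> space (prob_algebra state_space)"
proof -
  have \<nu>: "prob_space \<nu>" "sets \<nu> = sets state_space"
    using assms by (simp_all add: space_prob_algebra)
  interpret \<nu>: prob_space \<nu> by fact
  interpret pair_prob_space \<nu> \<mu> ..
  show ?thesis
    using P.prob_space_distr[OF measurable_Phi_pair[OF \<nu>(2)]]
    by (simp add: space_prob_algebra forward_def)
qed

lemma law_in_prob_algebra: "law n \<in> space (prob_algebra state_space)"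
proof (induction n)
  case 0
  then show ?case
    by (simp add: law_def space_prob_algebra prob_space_return)
next
  case (Suc n)
  then show ?case using forward_in_prob_algebra by (simp add: law_def)
qed

lemma sets_law [simp]: "sets (law n) = sets state_space"
  and prob_space_law: "prob_space (law n)"
  using law_in_prob_algebra[of n] by (simp_all add: space_prob_algebra)

lemma nn_integral_law_Suc:
  "f \<in> borel_measurable state_space \<Longrightarrow>
    (\<integral>\<^sup>+ w. f w \<partial>law (Suc n)) = (\<integral>\<^sup>+ w. backward f w \<partial>law n)"
  using nn_integral_forward[OF sets_law] by (simp add: law_def)

text \<open>By duality each step is moved from the law onto the test function; since
  \<open>law 0\<close> is the unit mass at the empty system, evaluation at \<open>[]\<close>
  remains.\<close>

lemma nn_integral_law:
  "f \<in> borel_measurable state_space \<Longrightarrow> (\<integral>\<^sup>+ w. f w \<partial>law n) = (backward ^^ n) f []"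
proof (induction n arbitrary: f)
  case 0
  then show ?case by (simp add: law_def nn_integral_return)
next
  case (Suc n)
  then show ?case by (simp add: nn_integral_law_Suc funpow_swap1)
qed

text \<open>In the induction step invariance is applied to \<open>(backward ^^ n) f\<close>. The
  reset term contributes the value of this function at \<open>[]\<close>, which by
  \<open>nn_integral_law\<close> is the integral of \<open>f\<close> against
  \<open>law n\<close>.\<close>

lemma invariant_unfold:
  assumes "invariant \<pi>" and f: "f \<in> borel_measurable state_space"
  shows "(\<integral>\<^sup>+ w. f w \<partial>\<pi>) = (\<Sum>j<n. ennreal (q * (1 - q) ^ j) * (\<integral>\<^sup>+ w. f w \<partial>law j)) +
    ennreal ((1 - q) ^ n) * (\<integral>\<^sup>+ w. (backward ^^ n) f w \<partial>\<pi>)"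
proof (induction n)
  case 0
  then show ?case by simp
next
  case (Suc n)
  have "(\<integral>\<^sup>+ w. (backward ^^ n) f w \<partial>\<pi>) = ennreal q * (\<integral>\<^sup>+ w. f w \<partial>law n) +
      ennreal (1 - q) * (\<integral>\<^sup>+ w. (backward ^^ Suc n) f w \<partial>\<pi>)"
    unfolding nn_integral_law[OF f] funpow.simps(2) o_apply
    by (rule bspec[OF assms(1)[unfolded invariant_def] measurable_backward_funpow[OF f]])
  moreover have "ennreal (q * (1 - q) ^ n) = ennreal ((1 - q) ^ n) * ennreal q"
      "ennreal ((1 - q) ^ Suc n) = ennreal ((1 - q) ^ n) * ennreal (1 - q)"
    using q_pos q_less_1 by (simp_all add: mult.commute flip: ennreal_mult')
  ultimately have "ennreal ((1 - q) ^ n) * (\<integral>\<^sup>+ w. (backward ^^ n) f w \<partial>\<pi>) =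
      ennreal (q * (1 - q) ^ n) * (\<integral>\<^sup>+ w. f w \<partial>law n) +
      ennreal ((1 - q) ^ Suc n) * (\<integral>\<^sup>+ w. (backward ^^ Suc n) f w \<partial>\<pi>)"
    by (simp only: distrib_left mult.assoc)
  then show ?case
    unfolding Suc.IH sum.lessThan_Suc by (simp only: add.assoc)
qed

text \<open>For an indicator the remainder in \<open>invariant_unfold\<close> lies between 0 and
  \<open>(1 - q) ^ n\<close>, so the partial sums are squeezed to \<open>measure \<pi> A\<close>. In
  particular there is at most one invariant probability law.\<close>

lemma invariant_sums:
  assumes "invariant \<pi>" and "\<pi> \<in> space (prob_algebra state_space)"
    and A: "A \<in> sets state_space"
  shows "(\<lambda>j. q * (1 - q) ^ j * measure (law j) A) sums measure \<pi> A"
proof -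
  interpret \<pi>: prob_space \<pi> using assms(2) by (simp add: space_prob_algebra)
  have sets_\<pi>: "sets \<pi> = sets state_space" using assms(2) by (simp add: space_prob_algebra)
  define s where "s n = (\<Sum>j<n. q * (1 - q) ^ j * measure (law j) A)" for n
  have s_nonneg: "0 \<le> s n" for n
    unfolding s_def using q_pos q_less_1 by (intro sum_nonneg) simp
  have unfold: "ennreal (measure \<pi> A) =
      ennreal (s n) + ennreal ((1 - q) ^ n) * (\<integral>\<^sup>+ w. (backward ^^ n) (indicator A) w \<partial>\<pi>)" for n
  proof -
    have "emeasure (law j) A = ennreal (measure (law j) A)" for j
      using prob_space_law by (simp add: finite_measure.emeasure_eq_measure prob_space.finite_measure)
    then have "(\<Sum>j<n. ennreal (q * (1 - q) ^ j) * (\<integral>\<^sup>+ w. indicator A w \<partial>law j)) = ennreal (s n)"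
      using q_pos q_less_1 A
      by (simp add: s_def flip: ennreal_mult'')
    then show ?thesis
      using invariant_unfold[OF assms(1), of "indicator A" n] A
      by (simp add: sets_\<pi> \<pi>.emeasure_eq_measure)
  qed
  have lower: "s n \<le> measure \<pi> A" for n
    using unfold[of n] s_nonneg[of n]
    by (metis ennreal_le_iff le_iff_add measure_nonneg)
  have upper: "measure \<pi> A \<le> s n + (1 - q) ^ n" for n
  proof -
    have "(\<integral>\<^sup>+ w. (backward ^^ n) (indicator A) w \<partial>\<pi>) \<le> (\<integral>\<^sup>+ w. 1 \<partial>\<pi>)"
      by (intro nn_integral_mono backward_funpow_le_1) (simp add: indicator_def)
    then have "ennreal ((1 - q) ^ n) * (\<integral>\<^sup>+ w. (backward ^^ n) (indicator A) w \<partial>\<pi>)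
        \<le> ennreal ((1 - q) ^ n) * 1"
      by (intro mult_left_mono) (simp_all add: \<pi>.emeasure_space_1)
    then have "ennreal (measure \<pi> A) \<le> ennreal (s n) + ennreal ((1 - q) ^ n)"
      unfolding unfold[of n] by (intro add_left_mono) simp
    then show ?thesis
      using s_nonneg[of n] q_less_1 by (simp flip: ennreal_plus)
  qed
  have "(\<lambda>n. measure \<pi> A - (1 - q) ^ n) \<longlonglongrightarrow> measure \<pi> A - 0"
    using q_pos q_less_1 by (intro tendsto_diff tendsto_const LIMSEQ_power_zero) simp
  then have "s \<longlonglongrightarrow> measure \<pi> A"
    using lower upper
    by (intro tendsto_sandwich[of "\<lambda>n. measure \<pi> A - (1 - q) ^ n" s _ "\<lambda>_. measure \<pi> A"])
       (auto simp: algebra_simps)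
  then show ?thesis
    by (simp add: sums_def s_def[abs_def])
qed

text \<open>In equilibrium, the number of steps since the last reset is geometrically distributed.\<close>

lemma invariant_exists: "\<exists>\<pi>. \<pi> \<in> space (prob_algebra state_space) \<and> invariant \<pi>"
proof (intro exI conjI)
  let ?g = "measure_pmf (geometric_pmf q)"
  have law: "law \<in> ?g \<rightarrow>\<^sub>M prob_algebra state_space"
    using law_in_prob_algebra by (simp add: measurable_def)
  have nn_integral: "(\<integral>\<^sup>+ w. f w \<partial>(?g \<bind> law)) =
      (\<Sum>j. ennreal (q * (1 - q) ^ j) * (\<integral>\<^sup>+ w. f w \<partial>law j))"
    if "f \<in> borel_measurable state_space" for f
    using q_pos q_less_1 nn_integral_bind[OF that measurable_prob_algebraD[OF law]]
    by (simp add: nn_integral_measure_pmf nn_integral_count_space_nat mult_ac)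
  show "?g \<bind> law \<in> space (prob_algebra state_space)"
    using prob_space_bind'[OF _ law] sets_bind'[OF _ law]
    by (simp add: space_prob_algebra measure_pmf.prob_space_axioms)
  show "invariant (?g \<bind> law)"
    unfolding invariant_def
  proof
    fix f :: "real list \<Rightarrow> ennreal" assume f: "f \<in> borel_measurable state_space"
    \<comment> \<open>One backward step turns \<open>law j\<close> into \<open>law (Suc j)\<close>,
      and the factor \<open>1 - q\<close> raises the weight accordingly. This is the mixture without
      its term at index 0, which the reset supplies because \<open>law 0\<close> is the unit mass at
      \<open>[]\<close>.\<close>
    have "ennreal (1 - q) * (\<integral>\<^sup>+ w. backward f w \<partial>(?g \<bind> law)) =
        (\<Sum>j. ennreal (q * (1 - q) ^ Suc j) * (\<integral>\<^sup>+ w. f w \<partial>law (Suc j)))"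
    proof -
      have "ennreal (1 - q) * ennreal (q * (1 - q) ^ j) = ennreal (q * (1 - q) ^ Suc j)" for j
        using q_less_1 by (simp add: mult_ac flip: ennreal_mult')
      then show ?thesis
        unfolding nn_integral[OF measurable_backward[OF f]] nn_integral_law_Suc[OF f]
          ennreal_suminf_cmult[symmetric]
        by (simp only: mult.assoc[symmetric])
    qed
    moreover have "ennreal q * f [] = ennreal (q * (1 - q) ^ 0) * (\<integral>\<^sup>+ w. f w \<partial>law 0)"
      using nn_integral_law[OF f, of 0] by simp
    ultimately show "(\<integral>\<^sup>+ w. f w \<partial>(?g \<bind> law)) =
        ennreal q * f [] + ennreal (1 - q) * (\<integral>\<^sup>+ w. backward f w \<partial>(?g \<bind> law))"
      unfolding nn_integral[OF f]
      by (subst suminf_offset[where i = 1]) (simp_all add: add.commute)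
  qed
qed

section \<open>Invariance and stationarity of the reset chain\<close>

abbreviation driver :: "((real \<times> real) \<times> bool) measure" where
  "driver \<equiv> \<mu> \<Otimes>\<^sub>M measure_pmf (bernoulli_pmf q)"

lemma measurable_chain_step [measurable]:
  assumes [measurable]: "g \<in> N \<rightarrow>\<^sub>M state_space" "d \<in> N \<rightarrow>\<^sub>M driver"
  shows "(\<lambda>x. chain_step (g x) (d x)) \<in> N \<rightarrow>\<^sub>M state_space"
proof -
  have "(\<lambda>x. fst (d x)) \<in> N \<rightarrow>\<^sub>M \<mu>" "(\<lambda>x. snd (d x)) \<in> N \<rightarrow>\<^sub>M measure_pmf (bernoulli_pmf q)"
    by measurable
  then have [measurable]: "(\<lambda>x. fst (fst (d x))) \<in> borel_measurable N"
      "(\<lambda>x. snd (fst (d x))) \<in> borel_measurable N" "Measurable.pred N (\<lambda>x. snd (d x))"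
    using measurable_compose[OF _ measurable_fst_\<mu>] measurable_compose[OF _ measurable_snd_\<mu>]
    by (simp_all add: measurable_cong_sets[OF refl sets_measure_pmf_count_space])
  have [measurable]: "(\<lambda>x. Phi (g x) (fst (fst (d x))) (snd (fst (d x)))) \<in> N \<rightarrow>\<^sub>M state_space"
    by (rule measurable_Phi) fact+
  show ?thesis
    unfolding chain_step_def by (rule measurable_If) simp_all
qed

lemma nn_integral_chain_step:
  assumes [measurable]: "f \<in> borel_measurable state_space" and "w \<in> states"
  shows "(\<integral>\<^sup>+ d. f (chain_step w d) \<partial>driver) = ennreal q * f [] + ennreal (1 - q) * backward f w"
proof -
  note [measurable] = const_in_state_space[OF assms(2)]
  have "(\<integral>\<^sup>+ d. f (chain_step w d) \<partial>driver) =
      (\<integral>\<^sup>+ z. \<integral>\<^sup>+ r. f (chain_step w (z, r)) \<partial>measure_pmf (bernoulli_pmf q) \<partial>\<mu>)"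
    by (rule measure_pmf.nn_integral_fst[symmetric]) measurable
  also have "\<dots> = (\<integral>\<^sup>+ z. ennreal q * f [] + ennreal (1 - q) * f (Phi w (fst z) (snd z)) \<partial>\<mu>)"
    using q_pos q_less_1 by (simp add: chain_step_def mult_ac)
  also have "\<dots> = ennreal q * f [] + ennreal (1 - q) * backward f w"
    unfolding backward_def
    by (subst nn_integral_add) (simp_all add: nn_integral_cmult emeasure_space_1)
  finally show ?thesis .
qed

text \<open>Makes \<open>PiM_iter\<close> available: the i.i.d. sequence has the law of an
  independent first term put in front of a fresh copy.\<close>

lemma sequence_space_driver: "sequence_space driver"
proof -
  interpret pair_prob_space \<mu> "measure_pmf (bernoulli_pmf q)" ..
  show ?thesis
    by (intro sequence_space.intro product_prob_spaceI) (rule P.prob_space_axioms)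
qed

text \<open>Conditioning on the first driving term yields a recursion for \<open>run n f\<close>.
  Stationarity at time 1 is then invariance; conversely, invariance applied to
  \<open>run n f\<close> shows that the mean of \<open>f\<close> at time \<open>n + 1\<close> equals
  the mean at time \<open>n\<close>.\<close>

lemma stationary_iff_invariant:
  assumes G: "cdf_measure G = \<mu>" and \<pi>: "\<pi> \<in> space (prob_algebra state_space)"
  shows "stationary_distribution q G \<pi> \<longleftrightarrow> invariant \<pi>"
proof -
  interpret sequence_space driver by (rule sequence_space_driver)
  interpret \<pi>: prob_space \<pi> using \<pi> by (simp add: space_prob_algebra)
  have sets_\<pi>: "sets \<pi> = sets state_space" using \<pi> by (simp add: space_prob_algebra)
  have space_\<pi>: "space \<pi> = states" using sets_eq_imp_space_eq[OF sets_\<pi>] by simp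
  have workload [measurable]:
    "g \<in> N \<rightarrow>\<^sub>M state_space \<Longrightarrow> h \<in> N \<rightarrow>\<^sub>M S \<Longrightarrow>
      (\<lambda>x. workload (g x) (h x) n) \<in> N \<rightarrow>\<^sub>M state_space" for g h n and N :: "'c measure"
  proof (induction n)
    case 0
    then show ?case by simp
  next
    case (Suc n)
    note [measurable] = Suc
    show ?case unfolding workload_Suc by measurable
  qed
  \<comment> \<open>The mean of \<open>f\<close> at time \<open>n\<close> for the chain started in
    the fixed state \<open>w\<close>.\<close>
  define run where "run n f w = (\<integral>\<^sup>+ \<omega>. f (workload w \<omega> n) \<partial>S)"
    for n and f :: "real list \<Rightarrow> ennreal" and w
  let ?L = "\<lambda>n. distr (chain_space q G \<pi>) state_space (\<lambda>(w, \<omega>). workload w \<omega> n)"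
  have run: "run n f \<in> borel_measurable state_space" "(\<integral>\<^sup>+ w. f w \<partial>?L n) = (\<integral>\<^sup>+ w. run n f w \<partial>\<pi>)"
    if [measurable]: "f \<in> borel_measurable state_space" for n f
  proof -
    show "run n f \<in> borel_measurable state_space"
      unfolding run_def by measurable
    have "(\<lambda>(w, \<omega>). workload w \<omega> n) \<in> state_space \<Otimes>\<^sub>M S \<rightarrow>\<^sub>M state_space"
      by measurable
    then have [measurable]: "(\<lambda>(w, \<omega>). workload w \<omega> n) \<in> \<pi> \<Otimes>\<^sub>M S \<rightarrow>\<^sub>M state_space"
      using measurable_cong_sets[OF sets_pair_measure_cong[OF sets_\<pi> refl, of S] refl, of state_space]
      by simp
    have "(\<integral>\<^sup>+ w. f w \<partial>?L n) = (\<integral>\<^sup>+ x. f (case x of (w, \<omega>) \<Rightarrow> workload w \<omega> n) \<partial>(\<pi> \<Otimes>\<^sub>M S))"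
      unfolding chain_space_def G by (rule nn_integral_distr) measurable
    also have "\<dots> = (\<integral>\<^sup>+ w. run n f w \<partial>\<pi>)"
      unfolding run_def by (subst P.nn_integral_fst[symmetric]) simp_all
    finally show "(\<integral>\<^sup>+ w. f w \<partial>?L n) = (\<integral>\<^sup>+ w. run n f w \<partial>\<pi>)" .
  qed
  have run_Suc: "run (Suc n) f w = ennreal q * run n f [] + ennreal (1 - q) * backward (run n f) w"
    if [measurable]: "f \<in> borel_measurable state_space" and w: "w \<in> states" for n f w
  proof -
    have run_w: "(\<lambda>\<omega>. f (workload w \<omega> (Suc n))) \<in> borel_measurable S"
      by (rule measurable_compose[OF workload[OF const_in_state_space[OF w] measurable_ident_sets[OF refl]] that(1)])
    have step: "(\<lambda>x. f (workload (chain_step w (fst x)) (snd x) n)) \<in> borel_measurable (driver \<Otimes>\<^sub>M S)"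
      by (rule measurable_compose[OF workload[OF measurable_chain_step[OF const_in_state_space[OF w]
        measurable_fst] measurable_snd] that(1)])
    \<comment> \<open>The driving sequence is replaced by \<open>case_nat d \<omega>\<close> with an
      independent \<open>d\<close>. The first step then leads to \<open>chain_step w d\<close>, from
      which \<open>n\<close> further steps are run.\<close>
    have "run (Suc n) f w =
        (\<integral>\<^sup>+ \<omega>. f (workload w \<omega> (Suc n)) \<partial>distr (driver \<Otimes>\<^sub>M S) S (\<lambda>(d, \<omega>). case_nat d \<omega>))"
      unfolding run_def PiM_iter ..
    also have "\<dots> = (\<integral>\<^sup>+ x. f (workload w (case x of (d, \<omega>) \<Rightarrow> case_nat d \<omega>) (Suc n)) \<partial>(driver \<Otimes>\<^sub>M S))"
    proof (rule nn_integral_distr)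
      show "(\<lambda>(d, \<omega>). case_nat d \<omega>) \<in> driver \<Otimes>\<^sub>M S \<rightarrow>\<^sub>M S"
        by measurable
    qed (use run_w in \<open>simp only: measurable_distr_eq1\<close>)
    also have "\<dots> = (\<integral>\<^sup>+ x. f (workload (chain_step w (fst x)) (snd x) n) \<partial>(driver \<Otimes>\<^sub>M S))"
      by (simp only: split_beta workload_case_nat)
    also have "\<dots> = (\<integral>\<^sup>+ d. run n f (chain_step w d) \<partial>driver)"
      unfolding run_def P.nn_integral_fst[OF step, symmetric] by simp
    also have "\<dots> = ennreal q * run n f [] + ennreal (1 - q) * backward (run n f) w"
      by (rule nn_integral_chain_step[OF run(1) w]) fact
    finally show ?thesis .
  qed
  have integral_run_Suc: "(\<integral>\<^sup>+ w. run (Suc n) f w \<partial>\<pi>) =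
      ennreal q * run n f [] + ennreal (1 - q) * (\<integral>\<^sup>+ w. backward (run n f) w \<partial>\<pi>)"
    if f: "f \<in> borel_measurable state_space" for n f
  proof -
    have [measurable]: "backward (run n f) \<in> borel_measurable \<pi>"
      using measurable_backward[OF run(1)[OF f]] by (simp add: measurable_cong_sets[OF sets_\<pi> refl])
    have "(\<integral>\<^sup>+ w. run (Suc n) f w \<partial>\<pi>) =
        (\<integral>\<^sup>+ w. ennreal q * run n f [] + ennreal (1 - q) * backward (run n f) w \<partial>\<pi>)"
      by (intro nn_integral_cong) (simp add: run_Suc[OF f] space_\<pi>)
    then show ?thesis
      by (simp add: nn_integral_add nn_integral_cmult \<pi>.emeasure_space_1)
  qed
  have run_0: "run 0 f = f" for f
    by (simp add: run_def fun_eq_iff emeasure_space_1)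
  show ?thesis
  proof
    assume stat: "stationary_distribution q G \<pi>"
    show "invariant \<pi>"
      unfolding invariant_def
    proof
      fix f :: "real list \<Rightarrow> ennreal" assume f: "f \<in> borel_measurable state_space"
      have L: "?L (Suc 0) = \<pi>"
        using stat unfolding stationary_distribution_def by blast
      have "(\<integral>\<^sup>+ w. f w \<partial>\<pi>) = (\<integral>\<^sup>+ w. run (Suc 0) f w \<partial>\<pi>)"
        using run(2)[OF f, of "Suc 0"] unfolding L .
      also have "\<dots> = ennreal q * f [] + ennreal (1 - q) * (\<integral>\<^sup>+ w. backward f w \<partial>\<pi>)"
        unfolding integral_run_Suc[OF f] run_0 ..
      finally show "(\<integral>\<^sup>+ w. f w \<partial>\<pi>) =
          ennreal q * f [] + ennreal (1 - q) * (\<integral>\<^sup>+ w. backward f w \<partial>\<pi>)" .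
    qed
  next
    assume inv: "invariant \<pi>"
    have const: "(\<integral>\<^sup>+ w. run n f w \<partial>\<pi>) = (\<integral>\<^sup>+ w. f w \<partial>\<pi>)" if f: "f \<in> borel_measurable state_space" for n f
    proof (induction n)
      case (Suc n)
      have "(\<integral>\<^sup>+ w. run (Suc n) f w \<partial>\<pi>) = (\<integral>\<^sup>+ w. run n f w \<partial>\<pi>)"
        unfolding integral_run_Suc[OF f]
        by (rule sym[OF bspec[OF inv[unfolded invariant_def] run(1)[OF f]]])
      with Suc show ?case by simp
    qed (simp add: run_0)
    have "?L n = \<pi>" for n
    proof (rule measure_eqI)
      fix A assume "A \<in> sets (?L n)"
      then have A: "A \<in> sets state_space" by simp
      have "emeasure (?L n) A = (\<integral>\<^sup>+ w. indicator A w \<partial>?L n)"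
        using A by simp
      also have "\<dots> = (\<integral>\<^sup>+ w. indicator A w \<partial>\<pi>)"
        using A by (subst run(2), simp, intro const) simp
      also have "\<dots> = emeasure \<pi> A"
        using A by (simp add: sets_\<pi>)
      finally show "emeasure (?L n) A = emeasure \<pi> A" .
    qed (simp add: sets_\<pi>)
    with \<pi> show "stationary_distribution q G \<pi>"
      by (simp add: stationary_distribution_def)
  qed
qed

subsection \<open>The operator on describing sequences\<close>

text \<open>By Fubini, \<open>K_entry\<close> at \<open>l\<close> is the probability, under
  \<open>\<nu>\<close> and an independent pair, that the old state has \<open>l\<close> entries and
  the new one lies in the lower set. Summing over the disjoint pieces gives the law after one
  step.\<close>

lemma K_op_eq_forward:
  assumes G: "cdf_measure G = \<mu>" and nonneg: "AE z in \<mu>. 0 \<le> fst z \<and> 0 \<le> snd z"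
    and \<nu>: "\<nu> \<in> space (prob_algebra state_space)"
    and H: "\<And>k x. x \<in> ordvec k \<Longrightarrow> H k x = measure \<nu> (lower_set k x)"
  shows "K_op G H k x = measure (forward \<nu>) (lower_set k x)"
proof -
  interpret \<nu>: prob_space \<nu> using \<nu> by (simp add: space_prob_algebra)
  interpret \<nu>\<mu>: pair_prob_space \<nu> \<mu> ..
  have sets_\<nu>: "sets \<nu> = sets state_space" using \<nu> by (simp add: space_prob_algebra)
  have space_\<nu>: "space \<nu> = states" using sets_eq_imp_space_eq[OF sets_\<nu>] by simp
  define E where "E l = {p \<in> space (\<nu> \<Otimes>\<^sub>M \<mu>). fst p \<in> ordvec l \<and>
    (case p of (w, z) \<Rightarrow> Phi w (fst z) (snd z)) \<in> lower_set k x}" for l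
  note [measurable] = measurable_Phi_pair[OF sets_\<nu>]
  have [measurable]: "ordvec l \<in> sets \<nu>" for l
    by (simp add: sets_\<nu>)
  have E [measurable]: "E l \<in> sets (\<nu> \<Otimes>\<^sub>M \<mu>)" for l
    unfolding E_def by measurable
  have slice: "(\<lambda>w. (w, z)) -` E l = {w \<in> ordvec l. Phi w (fst z) (snd z) \<in> lower_set k x}" for z l
    using ordvec_subset_states by (auto simp: E_def space_pair_measure space_\<nu> space_\<mu>)
  have slice_sets: "(\<lambda>w. (w, z)) -` E l \<in> sets \<nu>" for z l
    by (rule sets_Pair2[OF E])
  have entry: "K_entry G k l (H l) x = measure (\<nu> \<Otimes>\<^sub>M \<mu>) (E l)" for l
  proof -
    have piece: "piece_measure l (H l) = restrict_space \<nu> (ordvec l)"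
      using H by (intro piece_measure_eq \<nu>.finite_measure_axioms sets_\<nu>)
    have restrict: "indicator (ordvec l) w *\<^sub>R indicator (lower_set k x) (Phi w (fst z) (snd z)) =
        (indicator ((\<lambda>w. (w, z)) -` E l) w :: real)" for w z
      by (simp add: slice indicator_def)
    have inner: "(LINT w|piece_measure l (H l). indicator (lower_set k x) (Phi w (fst z) (snd z))) =
        measure \<nu> ((\<lambda>w. (w, z)) -` E l)" for z
    proof -
      have "(LINT w|piece_measure l (H l). indicator (lower_set k x) (Phi w (fst z) (snd z))) =
        (LINT w|\<nu>. indicator ((\<lambda>w. (w, z)) -` E l) w :: real)"
        unfolding piece restrict[symmetric]
        by (rule integral_restrict_space) simp
      also have "\<dots> = measure \<nu> ((\<lambda>w. (w, z)) -` E l)"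
        using sets.Int_space_eq2[OF slice_sets] by simp
      finally show ?thesis .
    qed
    have [measurable]: "(\<lambda>z. measure \<nu> ((\<lambda>w. (w, z)) -` E l)) \<in> borel_measurable \<mu>"
      unfolding measure_def by (intro borel_measurable_enn2real \<nu>\<mu>.measurable_emeasure_Pair2 E)
    \<comment> \<open>The quadrant in \<open>K_entry\<close> carries all the mass of
      \<open>\<mu>\<close>, so integrating over the whole plane gives the same value.\<close>
    have "K_entry G k l (H l) x = (LINT z|\<mu>. measure \<nu> ((\<lambda>w. (w, z)) -` E l))"
      unfolding K_entry_def inner G set_lebesgue_integral_def
    proof (rule integral_cong_AE)
      have "indicator ({0..} \<times> {0..}) \<in> borel_measurable (borel :: (real \<times> real) measure)"
        by (intro borel_measurable_indicator borel_closed closed_Times closed_atLeast)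
      then have [measurable]: "(indicator ({0..} \<times> {0..}) :: real \<times> real \<Rightarrow> real) \<in> borel_measurable \<mu>"
        by (simp add: measurable_cong_sets[OF sets_\<mu> refl])
      show "(\<lambda>z. indicator ({0..} \<times> {0..}) z *\<^sub>R measure \<nu> ((\<lambda>w. (w, z)) -` E l)) \<in> borel_measurable \<mu>"
        by measurable
      show "AE z in \<mu>. indicator ({0..} \<times> {0..}) z *\<^sub>R measure \<nu> ((\<lambda>w. (w, z)) -` E l) =
          measure \<nu> ((\<lambda>w. (w, z)) -` E l)"
        using nonneg by eventually_elim (auto simp: indicator_def mem_Times_iff)
    qed measurable
    also have "\<dots> = enn2real (\<integral>\<^sup>+ z. emeasure \<nu> ((\<lambda>w. (w, z)) -` E l) \<partial>\<mu>)"
      by (subst integral_eq_nn_integral) (simp_all add: \<nu>.emeasure_eq_measure)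
    also have "\<dots> = measure (\<nu> \<Otimes>\<^sub>M \<mu>) (E l)"
      unfolding measure_def \<nu>\<mu>.emeasure_pair_measure_alt2[OF E] ..
    finally show ?thesis .
  qed
  have "disjoint_family E"
    by (auto simp: disjoint_family_on_def E_def ordvec_def)
  then have "(\<lambda>l. measure (\<nu> \<Otimes>\<^sub>M \<mu>) (E l)) sums measure (\<nu> \<Otimes>\<^sub>M \<mu>) (\<Union>l. E l)"
    using E by (intro \<nu>\<mu>.P.finite_measure_UNION) auto
  then have sum: "(\<Sum>\<^sub>\<infinity>l. measure (\<nu> \<Otimes>\<^sub>M \<mu>) (E l)) = measure (\<nu> \<Otimes>\<^sub>M \<mu>) (\<Union>l. E l)"
    by (intro infsumI sums_nonneg_imp_has_sum) simp_all
  \<comment> \<open>Fewer than \<open>k - 1\<close> entries cannot become \<open>k\<close> entries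
    by one arrival, so these empty events may be added to the sum.\<close>
  have empty: "E l = {}" if "l < k - 1" for l
  proof -
    have "Phi w u v \<notin> ordvec k" if "w \<in> ordvec l" for w u v
      using length_Phi_le[of w u v] ordvec_length[OF that] \<open>l < k - 1\<close>
      by (auto dest: ordvec_length)
    then show ?thesis
      using lower_set_subset by (fastforce simp: E_def)
  qed
  have "K_op G H k x = (\<Sum>\<^sub>\<infinity>l\<in>{k - 1..}. measure (\<nu> \<Otimes>\<^sub>M \<mu>) (E l))"
    by (simp add: K_op_def entry)
  also have "\<dots> = (\<Sum>\<^sub>\<infinity>l. measure (\<nu> \<Otimes>\<^sub>M \<mu>) (E l))"
    using empty by (intro infsum_cong_neutral) (auto simp: not_le)
  also have "\<dots> = measure (\<nu> \<Otimes>\<^sub>M \<mu>) (\<Union>l. E l)"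
    by (rule sum)
  also have "(\<Union>l. E l) = (\<lambda>(w, z). Phi w (fst z) (snd z)) -` lower_set k x \<inter> space (\<nu> \<Otimes>\<^sub>M \<mu>)"
    by (auto simp: E_def space_pair_measure space_\<nu> states_def)
  also have "measure (\<nu> \<Otimes>\<^sub>M \<mu>) \<dots> = measure (forward \<nu>) (lower_set k x)"
    unfolding forward_def by (rule measure_distr[symmetric]) measurable
  finally show ?thesis .
qed

text \<open>\<open>e1\<close> describes the unit mass at the empty system, and each application of
  \<open>K_op\<close> corresponds to one \<open>forward\<close> step of the law.\<close>

lemma K_op_funpow_e1:
  assumes G: "cdf_measure G = \<mu>" and nonneg: "AE z in \<mu>. 0 \<le> fst z \<and> 0 \<le> snd z"
    and "x \<in> ordvec k"
  shows "(K_op G ^^ j) e1 k x = measure (law j) (lower_set k x)"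
  using assms(3)
proof (induction j arbitrary: k x)
  case 0
  \<comment> \<open>The empty list belongs to the piece \<open>k = 0\<close> only, and there the
    sole corner is \<open>[]\<close> itself; this matches the values 1 and 0 of
    \<open>e1\<close>.\<close>
  have "[] \<in> lower_set k x \<longleftrightarrow> k = 0"
    using 0 by (auto simp: lower_set_def dest: ordvec_length)
  then show ?case
    by (simp add: law_def e1_def measure_return indicator_def)
next
  case (Suc j)
  have "K_op G ((K_op G ^^ j) e1) k x = measure (forward (law j)) (lower_set k x)"
    by (rule K_op_eq_forward[OF G nonneg law_in_prob_algebra Suc.IH])
  then show ?case by (simp add: law_def)
qed

end

section \<open>The law of the pair and the series for stationary laws\<close>

theorem theorem6p1:
  fixes q :: real and G :: "real \<Rightarrow> real \<Rightarrow> real"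
    and M :: "'a measure" and U V :: "'a \<Rightarrow> real"
  assumes "0 < q" and "q < 1"
    and "prob_space M"
    and "U \<in> borel_measurable M" and "V \<in> borel_measurable M"
    and "AE \<omega> in M. 0 \<le> U \<omega>" and "AE \<omega> in M. 0 \<le> V \<omega>"
    and "\<And>u v. G u v = measure M {\<omega> \<in> space M. U \<omega> \<le> u \<and> V \<omega> \<le> v}"
  shows "(\<exists>\<pi>. stationary_distribution q G \<pi>) \<and>
    (\<forall>k. \<forall>x\<in>ordvec k. summable (\<lambda>j. (1 - q) ^ j * (K_op G ^^ j) e1 k x)) \<and>
    (\<forall>\<pi> \<in> space (prob_algebra state_space).
       stationary_distribution q G \<pi> \<longleftrightarrow>
       (\<forall>k. \<forall>x\<in>ordvec k.
          describing_seq \<pi> k x = q * (\<Sum>j. (1 - q) ^ j * (K_op G ^^ j) e1 k x)))"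
proof -
  note [measurable] = assms(4,5)
  interpret M: prob_space M by fact
  define \<mu> where "\<mu> = distr M borel (\<lambda>\<omega>. (U \<omega>, V \<omega>))"
  interpret \<mu>: prob_space \<mu>
    unfolding \<mu>_def by (rule M.prob_space_distr) measurable
  interpret workload_chain \<mu> q
    by unfold_locales (use assms in \<open>simp_all add: \<mu>_def\<close>)
  have G: "cdf_measure G = \<mu>"
  proof (rule cdf_measure_eq)
    fix u v
    have "{..u} \<times> {..v} \<in> sets (borel :: (real \<times> real) measure)"
      by (intro borel_closed closed_Times closed_atMost)
    moreover have "(\<lambda>\<omega>. (U \<omega>, V \<omega>)) -` ({..u} \<times> {..v}) \<inter> space M = {\<omega> \<in> space M. U \<omega> \<le> u \<and> V \<omega> \<le> v}"
      by auto
    ultimately show "G u v = measure \<mu> ({..u} \<times> {..v})"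
      by (simp add: \<mu>_def measure_distr assms(8))
  qed (simp_all add: \<mu>.prob_space_axioms sets_\<mu>)
  have nonneg: "AE z in \<mu>. 0 \<le> fst z \<and> 0 \<le> snd z"
  proof -
    have "{z. 0 \<le> fst z \<and> 0 \<le> snd z} = {0 :: real..} \<times> {0 :: real..}"
      by auto
    also have "\<dots> \<in> sets borel"
      by (intro borel_closed closed_Times closed_atLeast)
    finally show ?thesis
      unfolding \<mu>_def using assms(6,7) by (subst AE_distr_iff) auto
  qed
  have K: "(K_op G ^^ j) e1 k x = measure (law j) (lower_set k x)" if "x \<in> ordvec k" for j k x
    by (rule K_op_funpow_e1[OF G nonneg that])
  have series: "summable (\<lambda>j. (1 - q) ^ j * (K_op G ^^ j) e1 k x)"
      "describing_seq \<pi> k x = q * (\<Sum>j. (1 - q) ^ j * (K_op G ^^ j) e1 k x)"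
    if "\<pi> \<in> space (prob_algebra state_space)" "invariant \<pi>" "x \<in> ordvec k" for \<pi> k x
  proof -
    have "(\<lambda>j. q * ((1 - q) ^ j * (K_op G ^^ j) e1 k x)) sums describing_seq \<pi> k x"
      using invariant_sums[OF that(2,1) sets_lower_set, of k x]
      by (simp add: describing_seq_def K[OF that(3)] mult.assoc)
    \<comment> \<open>Dividing by the positive \<open>q\<close> also gives summability of the series
      without this factor.\<close>
    from sums_divide[OF this, of q]
    have sums: "(\<lambda>j. (1 - q) ^ j * (K_op G ^^ j) e1 k x) sums (describing_seq \<pi> k x / q)"
      using assms(1) by simp
    then show "summable (\<lambda>j. (1 - q) ^ j * (K_op G ^^ j) e1 k x)"
      by (rule sums_summable)
    show "describing_seq \<pi> k x = q * (\<Sum>j. (1 - q) ^ j * (K_op G ^^ j) e1 k x)"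
      unfolding sums_unique[OF sums, symmetric] using assms(1) by simp
  qed
  obtain \<rho> where \<rho>: "\<rho> \<in> space (prob_algebra state_space)" "invariant \<rho>"
    using invariant_exists by blast
  show ?thesis
  proof (intro conjI ballI allI)
    show "\<exists>\<pi>. stationary_distribution q G \<pi>"
      using \<rho> stationary_iff_invariant[OF G] by blast
    show "summable (\<lambda>j. (1 - q) ^ j * (K_op G ^^ j) e1 k x)" if "x \<in> ordvec k" for k x
      using series(1)[OF \<rho> that] .
    fix \<pi> assume \<pi>: "\<pi> \<in> space (prob_algebra state_space)"
    show "stationary_distribution q G \<pi> \<longleftrightarrow> (\<forall>k. \<forall>x\<in>ordvec k.
        describing_seq \<pi> k x = q * (\<Sum>j. (1 - q) ^ j * (K_op G ^^ j) e1 k x))"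
      unfolding stationary_iff_invariant[OF G \<pi>]
    proof
      assume "invariant \<pi>"
      then show "\<forall>k. \<forall>x\<in>ordvec k.
          describing_seq \<pi> k x = q * (\<Sum>j. (1 - q) ^ j * (K_op G ^^ j) e1 k x)"
        using series(2)[OF \<pi>] by blast
    next
      assume "\<forall>k. \<forall>x\<in>ordvec k.
          describing_seq \<pi> k x = q * (\<Sum>j. (1 - q) ^ j * (K_op G ^^ j) e1 k x)"
      \<comment> \<open>The invariant law \<open>\<rho>\<close> has the same describing sequence,
        and a describing sequence determines its law.\<close>
      then have "\<pi> = \<rho>"
        using \<pi> \<rho>(1) series(2)[OF \<rho>]
        by (intro describing_seq_inj) (simp_all add: space_prob_algebra)
      with \<rho>(2) show "invariant \<pi>" by simp
    qed
  qed
qed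

end
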